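(* Let $\mathbb{K}$ be a field of characteristic zero. There is no supersolvable line arrangement $\mathcal{A}$ in $\mathbf{P}^2_{\mathbb{K}}$ with a modular point $p$ satisfying $\mu(p)\ge 2$ such that $n_2(H)=0$ for some $H\in\mathcal{A}\setminus\mathcal{A}_p$.
   Context: A line arrangement $\mathcal{A}$ in $\mathbf{P}^2_{\mathbb{K}}$ is a finite set of lines; standing assumption: the lines do not all pass through one common point. $L_2(\mathcal{A})$ is the set of points that are intersections of at least two lines of $\mathcal{A}$. For $p\in L_2(\mathcal{A})$, $\mathcal{A}_p=\{H\in\mathcal{A}\mid p\in H\}$ and $\mu(p)=|\mathcal{A}_p|-1$; $p$ is a double point if $\mu(p)=1$; $n_2(H)$ is the number of double points of $\mathcal{A}$ lying on $H$. $\mathcal{A}$ is supersolvable with modular point $p\in L_2(\mathcal{A})$ if for all distinct $H,L\in\mathcal{A}\setminus\mathcal{A}_p$ there is a unique $K\in\mathcal{A}_p$ with $H\cap L\subset K$. *)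

theory Defs
  imports "HOL-Analysis.Cartesian_Space"
begin

text \<open>The projective plane over a field: points are the one-dimensional subspaces of the
  three-dimensional coordinate space, and the line of a two-dimensional subspace is the set
  of all points contained in it.\<close>

definition proj_points :: "('k::field ^ 3) set set" where
  "proj_points = {P. vec.subspace P \<and> vec.dim P = 1}"

definition proj_lines :: "('k::field ^ 3) set set set" where
  "proj_lines = {{P \<in> proj_points. P \<subseteq> W} | W. vec.subspace W \<and> vec.dim W = 2}"

text \<open>The last conjunct is the standing assumption that the lines have no common point;
  in particular it excludes the empty arrangement.\<close>

definition line_arrangement :: "('k::field ^ 3) set set set \<Rightarrow> bool" where
  "line_arrangement A \<longleftrightarrow>
     finite A \<and> A \<subseteq> proj_lines \<and> \<not> (\<exists>p\<in>proj_points. \<forall>H\<in>A. p \<in> H)"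

definition L2 :: "('k::field ^ 3) set set set \<Rightarrow> ('k ^ 3) set set" where
  "L2 A = {p \<in> proj_points. \<exists>H\<in>A. \<exists>L\<in>A. H \<noteq> L \<and> p \<in> H \<inter> L}"

definition lines_through :: "('k::field ^ 3) set set set \<Rightarrow> ('k ^ 3) set \<Rightarrow> ('k ^ 3) set set set" where
  "lines_through A p = {H \<in> A. p \<in> H}"

text \<open>Only used for points of \<open>L2 A\<close>, where the subtraction does not truncate.\<close>

definition mu :: "('k::field ^ 3) set set set \<Rightarrow> ('k ^ 3) set \<Rightarrow> nat" where
  "mu A p = card (lines_through A p) - 1"

definition double_point :: "('k::field ^ 3) set set set \<Rightarrow> ('k ^ 3) set \<Rightarrow> bool" where
  "double_point A p \<longleftrightarrow> p \<in> L2 A \<and> mu A p = 1"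

definition n2 :: "('k::field ^ 3) set set set \<Rightarrow> ('k ^ 3) set set \<Rightarrow> nat" where
  "n2 A H = card {p. double_point A p \<and> p \<in> H}"

definition supersolvable_with_modular_point ::
    "('k::field ^ 3) set set set \<Rightarrow> ('k ^ 3) set \<Rightarrow> bool" where
  "supersolvable_with_modular_point A p \<longleftrightarrow>
     p \<in> L2 A \<and>
     (\<forall>H \<in> A - lines_through A p. \<forall>L \<in> A - lines_through A p.
        H \<noteq> L \<longrightarrow> (\<exists>!K. K \<in> lines_through A p \<and> H \<inter> L \<subseteq> K))"

end

theory Submission
  imports Defs "HOL-Computational_Algebra.Polynomial"
begin

text \<open>
  Choose coordinates in which the lines through \<open>p\<close> are vertical and \<open>H\<close> is the line \<open>y = 0\<close>, with
  one line through \<open>p\<close> at infinity and the others given by \<open>x = t\<close> for \<open>t\<close> in a finite set \<open>T\<close>. The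
  lines not through \<open>p\<close> become graphs \<open>y = l(x)\<close> of polynomials of degree at most 1, and modularity
  says that two of these graphs are parallel or meet over a point of \<open>T\<close>.

  Let \<open>Q\<close> be the product of all \<open>x - t\<close> with \<open>t\<close> in \<open>T\<close>. Newton interpolation yields a polynomial
  \<open>C(x, y)\<close> of total degree at most \<open>card T\<close> with \<open>C(x, l(x)) = l' Q\<close> for every such \<open>l\<close>; in other
  words \<open>Q \<partial>/\<partial>x + C \<partial>/\<partial>y\<close> is a logarithmic vector field of the arrangement. Let \<open>v(x)\<close> be the
  coefficient of \<open>y\<close> in \<open>C\<close>. If no point of \<open>H\<close> is a double point, then over each \<open>t\<close> in \<open>T\<close> another
  graph crosses \<open>H\<close>, which forces \<open>v(t) = Q'(t)\<close>, so \<open>v = Q'\<close>; and another graph is parallel to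
  \<open>H\<close>, which forces \<open>deg v \<le> card T - 2\<close>. In characteristic zero \<open>Q'\<close> has degree \<open>card T - 1\<close>.
\<close>

section \<open>Bivariate polynomials\<close>

text \<open>The outer index \<open>j\<close> is the exponent of y, the inner \<open>i\<close> that
  of x: \<open>[:- l, 1:]\<close> is y - l(x), and \<open>poly P l\<close> substitutes y = l(x). The
  bound is strict and 0 forces \<open>P = 0\<close>, so truncated differences like
  \<open>d - card A\<close> stay correct.\<close>

definition total_degree_less :: "nat \<Rightarrow> 'a::zero poly poly \<Rightarrow> bool" where
  "total_degree_less d P \<longleftrightarrow> (\<forall>i j. d \<le> i + j \<longrightarrow> coeff (coeff P j) i = 0)"

lemma total_degree_less_add:
  "total_degree_less d P \<Longrightarrow> total_degree_less d Q \<Longrightarrow> total_degree_less d (P + Q)"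
  by (simp add: total_degree_less_def)

lemma degree_le_1_cases:
  assumes "degree p \<le> 1"
  obtains a b where "p = [:b, a:]"
proof
  show "p = [:coeff p 0, coeff p 1:]"
    using assms by (auto simp: poly_eq_iff coeff_pCons coeff_eq_0 split: nat.split)
qed

lemma coeff_linear_mult:
  fixes l :: "'a::comm_ring_1 poly"
  assumes "degree l \<le> 1"
  shows "coeff (l * p) i = coeff l 0 * coeff p i + (case i of 0 \<Rightarrow> 0 | Suc i' \<Rightarrow> coeff l 1 * coeff p i')"
proof -
  obtain a b where l: "l = [:b, a:]"
    using assms by (rule degree_le_1_cases)
  show ?thesis
    by (simp add: l coeff_pCons split: nat.split)
qed

lemma total_degree_less_linear_mult:
  fixes l :: "'a::comm_ring_1 poly"
  assumes P: "total_degree_less d P" and l: "degree l \<le> 1"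
  shows "total_degree_less (Suc d) ([:- l, 1:] * P)"
  unfolding total_degree_less_def
proof (intro allI impI)
  fix i j assume d: "Suc d \<le> i + j"
  have "coeff (l * coeff P j) i = 0"
    using P d l by (auto simp: coeff_linear_mult total_degree_less_def split: nat.split)
  moreover have "coeff (coeff (pCons 0 P) j) i = 0"
    using P d by (auto simp: coeff_pCons total_degree_less_def split: nat.split)
  ultimately show "coeff (coeff ([:- l, 1:] * P) j) i = 0"
    by simp
qed

lemma total_degree_less_prod_linear:
  fixes A :: "'a::comm_ring_1 poly set"
  assumes "finite A" "\<And>k. k \<in> A \<Longrightarrow> degree k \<le> 1" "total_degree_less d P"
  shows "total_degree_less (d + card A) ((\<Prod>k\<in>A. [:- k, 1:]) * P)"
  using assms
proof (induction A rule: finite_induct)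
  case (insert k A)
  then show ?case
    using total_degree_less_linear_mult[of "d + card A" "(\<Prod>k\<in>A. [:- k, 1:]) * P" k]
    by (simp add: mult.assoc del: mult_pCons_left)
qed simp

text \<open>The divisor is monic in y, so the coefficients of \<open>R\<close> are determined from
  the top down. The induction descends in the exponent \<open>j\<close> of y, starting beyond
  \<open>degree R\<close>.\<close>

lemma total_degree_less_linear_quotient:
  fixes l :: "'a::comm_ring_1 poly"
  assumes P: "total_degree_less d ([:- l, 1:] * R)" and l: "degree l \<le> 1"
  shows "total_degree_less (d - 1) R"
proof -
  have R: "coeff R j = coeff ([:- l, 1:] * R) (Suc j) + l * coeff R (Suc j)" for j
    by simp
  have "\<forall>i. d \<le> Suc (i + j) \<longrightarrow> coeff (coeff R j) i = 0" for j
  proof (induction "Suc (degree R) - j" arbitrary: j)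
    case 0
    then show ?case by (simp add: coeff_eq_0)
  next
    case (Suc n)
    then have IH: "\<And>i. d \<le> Suc (i + Suc j) \<Longrightarrow> coeff (coeff R (Suc j)) i = 0"
      by simp
    show ?case
    proof (intro allI impI)
      fix i assume d: "d \<le> Suc (i + j)"
      have "coeff (l * coeff R (Suc j)) i = 0"
        using d IH l by (auto simp: coeff_linear_mult split: nat.split)
      moreover have "coeff (coeff ([:- l, 1:] * R) (Suc j)) i = 0"
        using P d unfolding total_degree_less_def by (metis add_Suc_right)
      ultimately show "coeff (coeff R j) i = 0"
        by (subst R) simp
    qed
  qed
  then show ?thesis
    by (auto simp: total_degree_less_def)
qed

text \<open>Repeated factor theorem; differences of distinct roots cancel in a domain. Below, the
  roots are polynomials in x: the graphs on which \<open>P\<close> vanishes.\<close>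

lemma prod_roots_factor:
  fixes P :: "'a::idom poly"
  assumes "finite A" "\<And>k. k \<in> A \<Longrightarrow> poly P k = 0"
  obtains R where "P = (\<Prod>k\<in>A. [:- k, 1:]) * R"
proof -
  have "\<exists>R. P = (\<Prod>k\<in>A. [:- k, 1:]) * R"
    using assms
  proof (induction A rule: finite_induct)
    case (insert k A)
    then obtain R where R: "P = (\<Prod>k\<in>A. [:- k, 1:]) * R"
      by auto
    have "(\<Prod>j\<in>A. k - j) \<noteq> 0"
      using insert.hyps by auto
    moreover have "poly P k = 0"
      using insert.prems by simp
    ultimately have "poly R k = 0"
      by (simp add: R poly_prod)
    then obtain R' where "R = [:- k, 1:] * R'"
      by (auto simp: poly_eq_0_iff_dvd elim: dvdE)
    then have "P = (\<Prod>j\<in>insert k A. [:- j, 1:]) * R'"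
      using insert.hyps by (simp add: R mult_ac del: mult_pCons_left mult_pCons_right)
    then show ?case ..
  qed simp
  then show thesis using that by blast
qed

lemma total_degree_less_prod_linear_quotient:
  fixes A :: "'a::comm_ring_1 poly set"
  assumes "finite A" "\<And>k. k \<in> A \<Longrightarrow> degree k \<le> 1"
    and "total_degree_less d ((\<Prod>k\<in>A. [:- k, 1:]) * R)"
  shows "total_degree_less (d - card A) R"
  using assms
proof (induction A arbitrary: d rule: finite_induct)
  case (insert k A)
  then have "total_degree_less (d - 1) ((\<Prod>k\<in>A. [:- k, 1:]) * R)"
    by (intro total_degree_less_linear_quotient[where l = k])
      (simp_all add: mult.assoc del: mult_pCons_left)
  then have "total_degree_less (d - 1 - card A) R"
    by (rule insert.IH[rotated]) (rule insert.prems(1), simp)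
  then show ?case
    using insert.hyps by simp
qed simp

lemma total_degree_less_poly:
  fixes l :: "'a::comm_ring_1 poly"
  assumes R: "total_degree_less d R" and l: "degree l \<le> 1" and i: "d \<le> i"
  shows "coeff (poly R l) i = 0"
  using R i
proof (induction R arbitrary: d i)
  case (pCons c R)
  have R: "total_degree_less (d - 1) R"
    unfolding total_degree_less_def
  proof (intro allI impI)
    fix i j assume "d - 1 \<le> i + j"
    then show "coeff (coeff R j) i = 0"
      using pCons.prems(1) unfolding total_degree_less_def
      by (metis Suc_eq_plus1 add_Suc_right coeff_pCons_Suc le_diff_conv)
  qed
  have "coeff c i = 0"
    using pCons.prems unfolding total_degree_less_def
    by (metis add.right_neutral coeff_pCons_0)
  moreover have "coeff (l * poly R l) i = 0"
  proof -
    have "coeff (poly R l) i = 0"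
      using pCons.IH[OF R] pCons.prems(2) by simp
    moreover have "coeff (poly R l) i' = 0" if "i = Suc i'" for i'
      using pCons.IH[OF R] pCons.prems(2) that by simp
    ultimately show ?thesis
      using l by (auto simp: coeff_linear_mult split: nat.split)
  qed
  ultimately show ?case by simp
qed simp

text \<open>The factors already split off do not vanish at \<open>t\<close>, so the cofactor
  \<open>q\<close> keeps the full order of \<open>p\<close> at \<open>t\<close>.\<close>

lemma prod_linear_powers_dvd:
  fixes p :: "'a::field poly"
  assumes "finite T" "\<And>t. t \<in> T \<Longrightarrow> [:- t, 1:] ^ e t dvd p"
  shows "(\<Prod>t\<in>T. [:- t, 1:] ^ e t) dvd p"
  using assms
proof (induction T rule: finite_induct)
  case (insert t T)
  then obtain q where q: "p = (\<Prod>t\<in>T. [:- t, 1:] ^ e t) * q"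
    by (auto elim: dvdE)
  show ?case
  proof (cases "p = 0")
    case False
    have "poly (\<Prod>t\<in>T. [:- t, 1:] ^ e t) t \<noteq> 0"
      using insert.hyps by (auto simp: poly_prod poly_power)
    then have "order t p = order t q"
      using False order_mult[of "\<Prod>t\<in>T. [:- t, 1:] ^ e t" q t] by (simp add: q order_0I)
    then have "[:- t, 1:] ^ e t dvd q"
      using False insert.prems[of t] by (auto simp: order_divides)
    then show ?thesis
      using insert.hyps by (simp add: q mult_dvd_mono mult.commute[of "[:- t, 1:] ^ e t"])
  qed simp
qed simp

section \<open>Interpolation of slopes\<close>

text \<open>One graph is added at a time. A multiple of the product of all y - k with
  \<open>k\<close> in \<open>S\<close> corrects the value on the new graph \<open>l\<close> and
  leaves the old ones alone. The error is divisible as required by \<open>cluster\<close>, and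
  \<open>D_infinity\<close> keeps the quotient small in degree.\<close>

lemma slope_interpolation:
  fixes S :: "'a::field poly set" and T :: "'a set"
  assumes "finite S" "finite T" "\<And>l. l \<in> S \<Longrightarrow> degree l \<le> 1"
    and "\<And>k l. k \<in> S \<Longrightarrow> l \<in> S \<Longrightarrow> coeff k 1 \<noteq> coeff l 1 \<Longrightarrow> \<exists>t\<in>T. poly k t = poly l t"
  shows "\<exists>C. total_degree_less (Suc (card T)) C \<and>
    (\<forall>l\<in>S. poly C l = smult (coeff l 1) (\<Prod>t\<in>T. [:- t, 1:]))"
  using assms(1,3,4)
proof (induction S rule: finite_induct)
  case empty
  show ?case by (intro exI[of _ 0]) (simp add: total_degree_less_def)
next
  case (insert l S)
  define Q where "Q = (\<Prod>t\<in>T. [:- t, 1:])"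
  have deg_Q: "degree Q = card T"
    unfolding Q_def by (subst degree_prod_eq_sum_degree) auto
  obtain C where C: "total_degree_less (Suc (card T)) C"
    and CS: "\<And>k. k \<in> S \<Longrightarrow> poly C k = smult (coeff k 1) Q"
    using insert by (auto simp: Q_def)
  have deg: "\<And>k. k \<in> insert l S \<Longrightarrow> degree k \<le> 1"
    using insert.prems by blast
  \<comment> \<open>\<open>D\<close> is the error of the old \<open>C\<close> on \<open>l\<close>.
    Graphs in \<open>I\<close> meet \<open>l\<close> at infinity and limit the degree of
    \<open>D\<close>; those in \<open>B\<close> meet it over \<open>T\<close> and force zeros of
    \<open>D\<close>.\<close>
  define D where "D = smult (coeff l 1) Q - poly C l"
  define I where "I = {k \<in> S. coeff k 1 = coeff l 1}"
  define B where "B = {k \<in> S. coeff k 1 \<noteq> coeff l 1}"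
  have fin: "finite I" "finite B" and S: "S = I \<union> B" "I \<inter> B = {}"
    using insert.hyps by (auto simp: I_def B_def)
  have const_diff: "\<exists>c. c \<noteq> 0 \<and> l - k = [:c:]" if "k \<in> I" for k
  proof -
    have "degree (l - k) \<le> 0"
    proof (rule degree_le, intro allI impI)
      fix i :: nat assume "0 < i"
      then show "coeff (l - k) i = 0"
        using that deg[of k] deg[of l]
        by (cases "i = 1") (auto simp: I_def coeff_eq_0)
    qed
    then obtain c where "l - k = [:c:]"
      by (metis degree_eq_zeroE le_zero_eq)
    moreover have "l - k \<noteq> 0"
      using that insert.hyps by (auto simp: I_def)
    ultimately show ?thesis by auto
  qed

  have const_I: "\<exists>c. c \<noteq> 0 \<and> (\<Prod>k\<in>I. l - k) = [:c:]"
    using fin(1) const_diff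
  proof (induction I rule: finite_induct)
    case empty
    show ?case by (auto simp: one_pCons)
  next
    case (insert k I)
    then obtain c c' where "(\<Prod>k\<in>I. l - k) = [:c:]" "c \<noteq> 0" "l - k = [:c':]" "c' \<noteq> 0"
      by blast
    then show ?case using insert.hyps by auto
  qed

  \<comment> \<open>Compare \<open>C\<close> with the field of constant slope
    \<open>coeff l 1\<close>, tangent to all parallels of \<open>l\<close>. The difference vanishes
    on \<open>I\<close>; splitting off these factors lowers the total degree by
    \<open>card I\<close>, and at y = l they become a nonzero constant.\<close>
  have D_infinity: "coeff D i = 0" if i: "Suc (card T) - card I \<le> i" for i
  proof -
    define P where "P = C - [:smult (coeff l 1) Q:]"
    have "total_degree_less (Suc (card T)) [:- smult (coeff l 1) Q:]"
      by (auto simp: total_degree_less_def coeff_pCons deg_Q coeff_eq_0 split: nat.split)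
    with C have "total_degree_less (Suc (card T)) (C + [:- smult (coeff l 1) Q:])"
      by (rule total_degree_less_add)
    also have "C + [:- smult (coeff l 1) Q:] = P"
      by (simp add: P_def poly_eq_iff coeff_pCons split: nat.split)
    finally have "total_degree_less (Suc (card T)) P" .
    moreover have "poly P k = 0" if "k \<in> I" for k
      using that by (auto simp: P_def I_def CS)
    then obtain R where R: "P = (\<Prod>k\<in>I. [:- k, 1:]) * R"
      using prod_roots_factor[OF fin(1)] by blast
    ultimately have "total_degree_less (Suc (card T) - card I) R"
      using fin deg S by (intro total_degree_less_prod_linear_quotient) auto
    then have "coeff (poly R l) i = 0"
      using i deg by (intro total_degree_less_poly) auto
    moreover have "D = - ((\<Prod>k\<in>I. l - k) * poly R l)"
    proof -
      have "poly P l = (\<Prod>k\<in>I. l - k) * poly R l"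
        by (simp add: R poly_prod)
      then show ?thesis by (simp add: D_def P_def algebra_simps)
    qed
    ultimately show ?thesis using const_I by auto
  qed

  have "\<forall>k\<in>B. \<exists>t\<in>T. poly k t = poly l t"
    using insert.prems(2) by (auto simp: B_def)
  then obtain \<tau> where \<tau>: "\<And>k. k \<in> B \<Longrightarrow> \<tau> k \<in> T \<and> poly k (\<tau> k) = poly l (\<tau> k)"
    by metis
  have diff: "l - k = smult (coeff l 1 - coeff k 1) [:- \<tau> k, 1:]" if k: "k \<in> B" for k
  proof -
    obtain a b where a: "l = [:b, a:]"
      using deg[of l] by (blast elim: degree_le_1_cases)
    obtain a' b' where a': "k = [:b', a':]"
      using deg[of k] k S(1) by (blast elim: degree_le_1_cases)
    show ?thesis
      using \<tau>[OF k] by (simp add: a a' algebra_simps)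
  qed
  text \<open>The polynomial \<open>P\<close> below compares \<open>C\<close> with the vector field \<open>Q \<partial>/\<partial>x + (\<dots>) \<partial>/\<partial>y\<close> tangent to all
    lines through the point of the graph of \<open>l\<close> over \<open>t\<close>.\<close>
  have cluster: "[:- t, 1:] ^ card {k \<in> B. \<tau> k = t} dvd D" if t: "t \<in> T" for t
  proof -
    define A where "A = {k \<in> B. \<tau> k = t}"
    define Q' where "Q' = (\<Prod>s\<in>T - {t}. [:- s, 1:])"
    have Q': "Q = [:- t, 1:] * Q'"
      using t assms(2) by (simp add: Q_def Q'_def prod.remove del: mult_pCons_left)
    define P where "P = C - [:smult (coeff l 1) Q - l * Q', Q':]"
    have "poly P k = 0" if "k \<in> A" for k
    proof -
      have "k \<in> B" and "\<tau> k = t"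
        using that by (auto simp: A_def)
      \<comment> \<open>Hence \<open>smult (coeff l 1) Q - (l - k) * Q'\<close> is
        \<open>smult (coeff k 1) Q\<close>, the value of \<open>C\<close> on
        \<open>k\<close>.\<close>
      then have "(l - k) * Q' = smult (coeff l 1 - coeff k 1) Q"
        using diff[of k] by (simp only: Q' mult_smult_left)
      moreover have "poly C k = smult (coeff k 1) Q"
        using \<open>k \<in> B\<close> CS by (auto simp: B_def)
      ultimately show ?thesis
        by (simp add: P_def algebra_simps smult_diff_left)
    qed
    then obtain R where R: "P = (\<Prod>k\<in>A. [:- k, 1:]) * R"
      using prod_roots_factor[of A P] fin by (auto simp: A_def)
    have "D = - poly P l"
      by (simp add: D_def P_def)
    also have "\<dots> = - ((\<Prod>k\<in>A. l - k) * poly R l)"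
      by (simp add: R poly_prod)
    also have "(\<Prod>k\<in>A. l - k) = (\<Prod>k\<in>A. smult (coeff l 1 - coeff k 1) [:- t, 1:])"
      using diff by (intro prod.cong) (auto simp: A_def)
    also have "\<dots> = smult (\<Prod>k\<in>A. coeff l 1 - coeff k 1) ([:- t, 1:] ^ card A)"
      by (simp only: prod_smult prod_constant)
    finally show ?thesis
      by (simp add: A_def[symmetric] dvd_smult)
  qed
  have "(\<Prod>k\<in>S. l - k) dvd D"
  proof -
    have "(\<Prod>k\<in>B. [:- \<tau> k, 1:]) = (\<Prod>t\<in>T. \<Prod>k\<in>{k \<in> B. \<tau> k = t}. [:- \<tau> k, 1:])"
      using fin assms(2) \<tau> by (intro prod.group[symmetric]) auto
    also have "\<dots> = (\<Prod>t\<in>T. [:- t, 1:] ^ card {k \<in> B. \<tau> k = t})"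
      by (intro prod.cong refl) simp
    also have "\<dots> dvd D"
      using assms(2) cluster by (rule prod_linear_powers_dvd)
    finally have "(\<Prod>k\<in>B. [:- \<tau> k, 1:]) dvd D" .
    moreover have "(\<Prod>k\<in>B. l - k) = smult (\<Prod>k\<in>B. coeff l 1 - coeff k 1) (\<Prod>k\<in>B. [:- \<tau> k, 1:])"
      using diff by (simp add: prod_smult[symmetric] cong: prod.cong)
    moreover have "(\<Prod>k\<in>B. coeff l 1 - coeff k 1) \<noteq> 0"
      using fin by (auto simp: B_def)
    ultimately have "(\<Prod>k\<in>B. l - k) dvd D"
      by (simp add: smult_dvd)
    moreover have "is_unit (\<Prod>k\<in>I. l - k)"
      using const_I by (auto simp: is_unit_const_poly_iff dvd_field_iff)
    ultimately show ?thesis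
      using fin S by (simp add: prod.union_disjoint mult_unit_dvd_iff')
  qed
  then obtain w where w: "D = (\<Prod>k\<in>S. l - k) * w"
    by (auto elim: dvdE)
  define E where "E = (\<Prod>k\<in>S. [:- k, 1:]) * [:w:]"
  have "total_degree_less (Suc (card T)) E"
  proof (cases "w = 0")
    case False
    have nz: "(\<Prod>k\<in>S. l - k) \<noteq> 0"
      using insert.hyps by auto
    have deg_B: "degree (l - k) = 1" if "k \<in> B" for k
      using that by (subst diff) (auto simp: B_def)
    have deg_I: "degree (l - k) = 0" if "k \<in> I" for k
      using const_diff[OF that] by auto
    have "degree (\<Prod>k\<in>S. l - k) = (\<Sum>k\<in>S. degree (l - k))"
      using insert.hyps by (intro degree_prod_eq_sum_degree) auto
    also have "\<dots> = card B"
      using fin S deg_B deg_I by (simp add: sum.union_disjoint)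
    \<comment> \<open>Only factors from \<open>B\<close> contribute degree, while
      \<open>D_infinity\<close> takes off \<open>card I\<close>. Together they leave
      \<open>degree w + card S \<le> card T\<close>, just what the total degree of \<open>E\<close>
      allows.\<close>
    finally have "degree D = card B + degree w"
      using False nz by (simp add: w degree_mult_eq)
    moreover have "D \<noteq> 0"
      using False nz by (simp add: w)
    then have "degree D < Suc (card T) - card I"
      using D_infinity[of "degree D"] by (metis leading_coeff_neq_0 not_le)
    moreover have "card S = card I + card B"
      using fin S by (simp add: card_Un_disjoint)
    ultimately have le: "degree w + card S < Suc (card T)"
      by simp
    then have "total_degree_less (Suc (card T) - card S) [:w:]"
      by (auto simp: total_degree_less_def coeff_pCons coeff_eq_0 split: nat.split)
    then show ?thesis
      using total_degree_less_prod_linear[of S "Suc (card T) - card S" "[:w:]"] le deg insert.hyps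
      by (simp add: E_def)
  qed (simp add: E_def total_degree_less_def)
  then have "total_degree_less (Suc (card T)) (C + E)"
    by (rule total_degree_less_add[OF C])
  moreover have "poly (C + E) k = smult (coeff k 1) Q" if "k \<in> insert l S" for k
  proof (cases "k = l")
    case True
    have "poly E l = D"
      by (simp add: E_def poly_prod w)
    then show ?thesis by (simp add: True D_def)
  next
    case False
    then have k: "k \<in> S" using that by simp
    then have "poly E k = 0"
      using insert.hyps by (auto simp: E_def poly_prod)
    then show ?thesis by (simp add: CS[OF k])
  qed
  ultimately show ?case
    unfolding Q_def by blast
qed

text \<open>The theorem in coordinates: \<open>0\<close> is the graph of \<open>H\<close>, and
  \<open>finite_dir\<close> and \<open>infinite_dir\<close> say that its crossings with each line x
  = t and with the line at infinity lie on a further graph.\<close>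

lemma no_saturated_pencil_sections:
  fixes S :: "'a::field_char_0 poly set" and T :: "'a set"
  assumes S: "finite S" "\<And>l. l \<in> S \<Longrightarrow> degree l \<le> 1" "0 \<in> S"
    and T: "finite T" "T \<noteq> {}"
    and meet: "\<And>k l. k \<in> S \<Longrightarrow> l \<in> S \<Longrightarrow> coeff k 1 \<noteq> coeff l 1 \<Longrightarrow> \<exists>t\<in>T. poly k t = poly l t"
    and finite_dir: "\<And>t. t \<in> T \<Longrightarrow> \<exists>l\<in>S. l \<noteq> 0 \<and> poly l t = 0"
    and infinite_dir: "\<exists>l\<in>S. l \<noteq> 0 \<and> coeff l 1 = 0"
  shows False
proof -
  define Q where "Q = (\<Prod>t\<in>T. [:- t, 1:])"
  have deg_Q: "degree Q = card T"
    unfolding Q_def by (subst degree_prod_eq_sum_degree) auto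
  obtain C where C: "total_degree_less (Suc (card T)) C"
    and CS: "\<And>l. l \<in> S \<Longrightarrow> poly C l = smult (coeff l 1) Q"
    using slope_interpolation[OF S(1) T(1) S(2) meet] unfolding Q_def by blast
  define v where "v = coeff C 1"
  have v_T: "poly v t = poly (pderiv Q) t" if t: "t \<in> T" for t
  proof -
    \<comment> \<open>\<open>Q'\<close> is the cofactor of x - t in \<open>Q\<close>, not the
      derivative; both take the same value at \<open>t\<close>.\<close>
    define Q' where "Q' = (\<Prod>s\<in>T - {t}. [:- s, 1:])"
    have Q': "Q = [:- t, 1:] * Q'"
      using t T(1) by (simp add: Q_def Q'_def prod.remove del: mult_pCons_left)
    obtain l where l: "l \<in> S" "l \<noteq> 0" "poly l t = 0"
      using finite_dir[OF t] by blast
    obtain a b where "l = [:b, a:]"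
      using S(2)[OF l(1)] by (rule degree_le_1_cases)
    then have l': "l = smult (coeff l 1) [:- t, 1:]"
      using l(3) by (simp add: algebra_simps add_eq_0_iff)
    \<comment> \<open>The subtracted y \<open>Q'\<close> belongs to a field tangent to all lines
      through (t, 0). So y (y - l) divides \<open>P\<close>, and the coefficient of y in
      \<open>P\<close> is a multiple of \<open>l\<close>, which vanishes at
      \<open>t\<close>.\<close>
    define P where "P = C - [:0, Q':]"
    have "poly P l = smult (coeff l 1) Q - l * Q'"
      by (simp add: P_def CS[OF l(1)])
    also have "l * Q' = smult (coeff l 1) Q"
      by (subst l') (simp only: Q' mult_smult_left)
    finally have "poly P l = 0" by simp
    moreover have "poly P 0 = 0"
      using CS[OF S(3)] by (simp add: P_def)
    ultimately obtain R where "P = (\<Prod>k\<in>{0, l}. [:- k, 1:]) * R"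
      using prod_roots_factor[of "{0, l}" P] by auto
    then have "coeff P 1 = - l * coeff R 0"
      using l(2) by simp
    then have "poly (coeff P 1) t = 0"
      using l(3) by simp
    then have "poly v t = poly Q' t"
      by (simp add: P_def v_def)
    also have "\<dots> = poly (pderiv Q) t"
      by (simp add: Q' pderiv_mult pderiv_pCons del: mult_pCons_left)
    finally show ?thesis .
  qed
  have "0 < card T" using T by (simp add: card_gt_0_iff)
  \<comment> \<open>\<open>C\<close> vanishes on \<open>0\<close> and on a parallel graph y = c, so
    C = y (y - c) R. Two degrees are lost in \<open>R\<close>, and \<open>v\<close> is -c times the
    y-free part of \<open>R\<close>.\<close>
  have "coeff v (card T - 1) = 0 \<and> degree v < card T"
  proof -
    obtain l where l: "l \<in> S" "l \<noteq> 0" "coeff l 1 = 0"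
      using infinite_dir by blast
    have "poly C l = 0" "poly C 0 = 0"
      using CS[OF l(1)] CS[OF S(3)] l(3) by simp_all
    then obtain R where R: "C = (\<Prod>k\<in>{0, l}. [:- k, 1:]) * R"
      using prod_roots_factor[of "{0, l}" C] by auto
    then have "total_degree_less (Suc (card T) - card {0, l}) R"
      using C S(2,3) l(1) by (intro total_degree_less_prod_linear_quotient) auto
    then have R': "total_degree_less (card T - 1) R"
      using l(2) by simp
    obtain a b where "l = [:b, a:]"
      using S(2)[OF l(1)] by (rule degree_le_1_cases)
    then have "l = [:coeff l 0:]"
      using l(3) by simp
    then obtain c where "l = [:c:]" ..
    then have "v = smult (- c) (coeff R 0)"
      using R l(2) by (simp add: v_def)
    then have "coeff v i = 0" if "card T - 1 \<le> i" for i
      using R' that by (simp add: total_degree_less_def)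
    then show ?thesis
      using \<open>0 < card T\<close>
      by (metis Suc_pred' degree_0 leading_coeff_0_iff le_refl less_Suc_eq_le nat_le_linear)
  qed
  \<comment> \<open>Both sides have degree below \<open>card T\<close> and agree on
    \<open>T\<close>; yet their coefficients at \<open>card T - 1\<close> are 0 and
    \<open>card T\<close>, which differ in characteristic zero.\<close>
  moreover from this have "v = pderiv Q"
    using v_T \<open>0 < card T\<close> by (intro poly_eqI_degree[of T]) (auto simp: degree_pderiv deg_Q)
  moreover have "coeff (pderiv Q) (card T - 1) = of_nat (card T)"
  proof -
    have "lead_coeff Q = 1"
      unfolding Q_def by (simp add: lead_coeff_prod)
    then show ?thesis
      using \<open>0 < card T\<close> deg_Q by (simp add: coeff_pderiv)
  qed
  ultimately show False
    using \<open>0 < card T\<close> by simp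
qed

section \<open>The projective plane\<close>

text \<open>The points of \<open>H\<close> cover its plane, the zero vector included because the
  plane has a nonzero vector. Incidence can thus be computed with vectors in
  \<open>\<Union>H\<close>.\<close>

lemma proj_lines_Union:
  fixes H :: "('k::field ^ 3) set set"
  assumes "H \<in> proj_lines"
  shows "vec.subspace (\<Union>H)" "vec.dim (\<Union>H) = 2" "H = {P \<in> proj_points. P \<subseteq> \<Union>H}"
proof -
  obtain W where H: "H = {P \<in> proj_points. P \<subseteq> W}" and W: "vec.subspace W" "vec.dim W = 2"
    using assms by (auto simp: proj_lines_def)
  have "v \<in> \<Union>H" if v: "v \<in> W" for v
  proof -
    obtain w where w: "w \<in> W" "w \<noteq> 0" "v \<in> vec.span {w}"
    proof (cases "v = 0")
      case True
      have "W \<noteq> {0}" using W(2) by auto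
      then obtain w where "w \<in> W" "w \<noteq> 0"
        using v True by blast
      then show thesis using that True by (simp add: vec.span_zero)
    next
      case False
      then show thesis using that v by (simp add: vec.span_base)
    qed
    then have "vec.span {w} \<in> H"
      using W(1) by (simp add: H proj_points_def vec.span_minimal)
    then show ?thesis using w(3) by blast
  qed
  then have "\<Union>H = W" by (auto simp: H)
  then show "vec.subspace (\<Union>H)" "vec.dim (\<Union>H) = 2" "H = {P \<in> proj_points. P \<subseteq> \<Union>H}"
    using W H by auto
qed

lemma span_in_proj_line_iff:
  fixes v :: "'k::field ^ 3"
  assumes "H \<in> proj_lines" "v \<noteq> 0"
  shows "vec.span {v} \<in> H \<longleftrightarrow> v \<in> \<Union>H"
proof
  show "v \<in> \<Union>H" if "vec.span {v} \<in> H"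
    using that by (meson UnionI vec.span_base singletonI)
next
  assume "v \<in> \<Union>H"
  then have "vec.span {v} \<subseteq> \<Union>H"
    using proj_lines_Union(1)[OF assms(1)] by (intro vec.span_minimal) auto
  moreover have "vec.span {v} \<in> proj_points"
    using assms(2) by (simp add: proj_points_def)
  ultimately show "vec.span {v} \<in> H"
    using proj_lines_Union(3)[OF assms(1)] by blast
qed

lemma proj_points_span:
  fixes p :: "('k::field ^ 3) set"
  assumes "p \<in> proj_points"
  obtains e where "e \<noteq> 0" "p = vec.span {e}"
proof -
  have p: "vec.subspace p" "vec.dim p = 1"
    using assms by (auto simp: proj_points_def)
  then have "p \<noteq> {0}" by auto
  then obtain e where e: "e \<in> p" "e \<noteq> 0"
    using vec.subspace_0[OF p(1)] by blast
  then have "vec.span {e} = p"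
    using p by (intro vec.subspace_dim_equal) (auto simp: vec.span_minimal)
  then show thesis using e that by blast
qed

lemma proj_line_span:
  fixes x y :: "'k::field ^ 3"
  assumes "H \<in> proj_lines" "x \<in> \<Union>H" "y \<in> \<Union>H" "y \<noteq> 0" "x \<notin> vec.span {y}"
  shows "\<Union>H = vec.span {x, y}"
proof -
  have ind: "vec.independent {x, y}"
    using assms(4,5) by (intro vec.independent_insertI) (auto simp: vec.independent_empty)
  have "x \<noteq> y"
    using assms(5) by (auto simp: vec.span_base)
  then have "\<Union>H \<subseteq> vec.span {x, y}"
    using assms(2,3) proj_lines_Union(2)[OF assms(1)] ind
    by (intro vec.card_ge_dim_independent) (simp_all del: Union_iff)
  moreover have "vec.span {x, y} \<subseteq> \<Union>H"
    using assms proj_lines_Union(1) by (intro vec.span_minimal) auto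
  ultimately show ?thesis by blast
qed

lemma proj_line_eqI:
  fixes x y :: "'k::field ^ 3"
  assumes "H \<in> proj_lines" "L \<in> proj_lines"
    and "x \<in> \<Union>H" "y \<in> \<Union>H" "x \<in> \<Union>L" "y \<in> \<Union>L" "y \<noteq> 0" "x \<notin> vec.span {y}"
  shows "H = L"
proof -
  have "\<Union>H = \<Union>L"
    using proj_line_span[of H x y] proj_line_span[of L x y] assms by simp
  then show ?thesis
    using proj_lines_Union(3)[OF assms(1)] proj_lines_Union(3)[OF assms(2)] by simp
qed

lemma proj_lines_meet:
  fixes H :: "('k::field ^ 3) set set"
  assumes "H \<in> proj_lines" "L \<in> proj_lines"
  obtains z where "z \<noteq> 0" "z \<in> \<Union>H" "z \<in> \<Union>L"
proof -
  have "vec.dim {x + y |x y. x \<in> \<Union>H \<and> y \<in> \<Union>L} + vec.dim (\<Union>H \<inter> \<Union>L) = 4"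
    using vec.dim_sums_Int[OF proj_lines_Union(1)[OF assms(1)] proj_lines_Union(1)[OF assms(2)]]
    by (simp only: proj_lines_Union(2)[OF assms(1)] proj_lines_Union(2)[OF assms(2)])
  moreover have "vec.dim {x + y |x y. x \<in> \<Union>H \<and> y \<in> \<Union>L} \<le> 3"
    using dim_subset_UNIV_cart_gen[where ?'a = 'k and ?'n = 3] by simp
  ultimately have "vec.dim (\<Union>H \<inter> \<Union>L) \<noteq> 0" by linarith
  then have "\<not> \<Union>H \<inter> \<Union>L \<subseteq> {0}" by simp
  then show thesis using that by blast
qed

text \<open>\<open>e\<close> and the plane \<open>\<Union>H\<close> span the space. With
  \<open>e\<close> spanning \<open>p\<close>, this projects from \<open>p\<close> onto
  \<open>H\<close> and makes lines off \<open>p\<close> into graphs.\<close>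

lemma proj_line_complement:
  fixes e :: "'k::field ^ 3"
  assumes H: "H \<in> proj_lines" and e: "e \<notin> \<Union>H"
  obtains c where "v + c *s e \<in> \<Union>H"
proof -
  note sub = proj_lines_Union(1)[OF H]
  have "e \<notin> vec.span (\<Union>H)"
    using e sub by (metis vec.span_eq_iff)
  then have "vec.dim (insert e (\<Union>H)) = 3"
    using proj_lines_Union(2)[OF H] by (simp add: vec.dim_insert)
  then have "vec.span (insert e (\<Union>H)) = UNIV"
    using vec.dim_eq_full[of "insert e (\<Union>H)"] vec_dim_card[where ?'a = 'k and ?'n = 3]
    by (simp add: vec.dimension_def)
  then obtain c where "v - c *s e \<in> vec.span (\<Union>H)"
    by (metis UNIV_I vec.span_breakdown_eq)
  then have "v + (- c) *s e \<in> \<Union>H"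
    using sub by (metis vec.span_eq_iff vec.scale_minus_left diff_conv_add_uminus)
  then show thesis by (rule that)
qed

text \<open>If only \<open>H\<close> and \<open>K\<close> passed through the point spanned by
  \<open>d\<close>, its \<open>mu\<close> would be 1.\<close>

lemma no_double_points_third_line:
  fixes A :: "('k::field ^ 3) set set set"
  assumes A: "finite A" "A \<subseteq> proj_lines" and H: "H \<in> A" and n2: "n2 A H = 0"
    and K: "K \<in> A" "K \<noteq> H" and d: "d \<noteq> 0" "d \<in> \<Union>H" "d \<in> \<Union>K"
  obtains L where "L \<in> A" "L \<noteq> H" "L \<noteq> K" "d \<in> \<Union>L"
proof -
  \<comment> \<open>\<open>card\<close> is 0 on infinite sets, so \<open>n2 A H = 0\<close> excludes
    double points only once there are finitely many: each lies on some \<open>H \<inter> L\<close>,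
    which has at most one point.\<close>
  have "finite {q. double_point A q \<and> q \<in> H}"
  proof (rule finite_subset)
    show "{q. double_point A q \<and> q \<in> H} \<subseteq> (\<Union>L\<in>A - {H}. H \<inter> L)"
      by (auto simp: double_point_def L2_def)
    have "finite (H \<inter> L)" if L: "L \<in> A - {H}" for L
    proof -
      have HL: "H \<in> proj_lines" "L \<in> proj_lines" "H \<noteq> L"
        using A H L by auto
      have "P = Q" if PQ: "P \<in> H \<inter> L" "Q \<in> H \<inter> L" for P Q
      proof -
        have "P \<in> proj_points" "Q \<in> proj_points"
          using PQ proj_lines_Union(3)[OF HL(1)] by blast+
        then obtain x y where x: "x \<noteq> 0" "P = vec.span {x}" and y: "y \<noteq> 0" "Q = vec.span {y}"
          by (metis proj_points_span)
        have "x \<in> \<Union>H" "x \<in> \<Union>L" "y \<in> \<Union>H" "y \<in> \<Union>L"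
          using PQ x y HL span_in_proj_line_iff by blast+
        then have "x \<in> vec.span {y}"
          using proj_line_eqI[OF HL(1,2)] y(1) HL(3) by blast
        then have "P \<subseteq> Q"
          by (simp add: x(2) y(2) vec.span_minimal)
        then show "P = Q"
          using \<open>P \<in> proj_points\<close> \<open>Q \<in> proj_points\<close>
          by (intro vec.subspace_dim_equal) (auto simp: proj_points_def)
      qed
      then show ?thesis
        by (metis finite.simps is_singletonI' is_singleton_def)
    qed
    then show "finite (\<Union>L\<in>A - {H}. H \<inter> L)"
      using A(1) by (intro finite_UN_I) (auto simp del: Int_iff)
  qed
  with n2 have no: "\<not> double_point A (vec.span {d})" if "vec.span {d} \<in> H"
    using that by (auto simp: n2_def)
  have dH: "vec.span {d} \<in> H" and dK: "vec.span {d} \<in> K"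
    using A(2) H K(1) d span_in_proj_line_iff by blast+
  have "vec.span {d} \<in> L2 A"
    using d H K dH dK by (auto simp: L2_def proj_points_def)
  then have "mu A (vec.span {d}) \<noteq> 1"
    using no dH by (auto simp: double_point_def)
  then have "lines_through A (vec.span {d}) \<noteq> {H, K}"
    using K(2) unfolding mu_def by (metis card_2_iff diff_add_inverse2 one_add_one)
  moreover have "{H, K} \<subseteq> lines_through A (vec.span {d})"
    using H K dH dK by (auto simp: lines_through_def)
  ultimately obtain L where "L \<in> A" "vec.span {d} \<in> L" "L \<noteq> H" "L \<noteq> K"
    unfolding lines_through_def by blast
  then show thesis
    using that[of L] A d(1) span_in_proj_line_iff by blast
qed

theorem theorem3p5:
  "\<not> (\<exists>(A :: ('k::field_char_0 ^ 3) set set set) p.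
        line_arrangement A \<and>
        supersolvable_with_modular_point A p \<and>
        mu A p \<ge> 2 \<and>
        (\<exists>H \<in> A - lines_through A p. n2 A H = 0))"
proof (intro notI, elim exE conjE bexE)
  fix A :: "('k ^ 3) set set set" and p H
  assume arr: "line_arrangement A" and ss: "supersolvable_with_modular_point A p"
    and mu: "mu A p \<ge> 2" and H: "H \<in> A - lines_through A p" and n2: "n2 A H = 0"
  have A: "finite A" "A \<subseteq> proj_lines"
    using arr by (auto simp: line_arrangement_def)
  note line = subsetD[OF A(2)]
  have "p \<in> proj_points"
    using ss by (auto simp: supersolvable_with_modular_point_def L2_def)
  then obtain e where e: "e \<noteq> 0" "p = vec.span {e}"
    by (rule proj_points_span)
  have through: "K \<in> lines_through A p \<longleftrightarrow> K \<in> A \<and> e \<in> \<Union>K" for K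
    using span_in_proj_line_iff[OF line e(1)] e(2) by (auto simp: lines_through_def)
  have add: "x + y \<in> \<Union>L" if "L \<in> A" "x \<in> \<Union>L" "y \<in> \<Union>L" for L x y
    using vec.subspace_add[OF proj_lines_Union(1)[OF line[OF that(1)]]] that by blast
  have diff: "x - y \<in> \<Union>L" if "L \<in> A" "x \<in> \<Union>L" "y \<in> \<Union>L" for L x y
    using vec.subspace_diff[OF proj_lines_Union(1)[OF line[OF that(1)]]] that by blast
  have scale: "c *s x \<in> \<Union>L" if "L \<in> A" "x \<in> \<Union>L" for L x c
    using vec.subspace_scale[OF proj_lines_Union(1)[OF line[OF that(1)]]] that by blast
  have unscale: "x \<in> \<Union>L" if "L \<in> A" "c *s x \<in> \<Union>L" "c \<noteq> 0" for L x c
    using scale[OF that(1,2), of "inverse c"] that(3) by (simp add: vector_smult_assoc)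
  have HA: "H \<in> A" and eH: "e \<notin> \<Union>H"
    using H through by auto

  \<comment> \<open>Coordinates adapted to \<open>p\<close> and \<open>H\<close>\<close>
  have "3 \<le> card (lines_through A p)"
    using mu by (auto simp: mu_def)
  \<comment> \<open>\<open>K1\<close> becomes the line at infinity; \<open>K2\<close> will show that
    \<open>T\<close> is nonempty.\<close>
  then obtain K1 K2 where K12: "K1 \<in> lines_through A p" "K2 \<in> lines_through A p" "K1 \<noteq> K2"
    by (metis card_le_Suc0_iff_eq card.infinite not_numeral_le_zero numeral_3_eq_3 Suc_le_mono
        Suc_leD not_less_eq_eq)
  then have K1: "K1 \<in> A" "e \<in> \<Union>K1"
    using through by auto
  obtain u where u: "u \<noteq> 0" "u \<in> \<Union>H" "u \<in> \<Union>K1"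
    using proj_lines_meet[OF line[OF HA] line[OF K1(1)]] .
  have "\<not> \<Union>H \<subseteq> vec.span {u}"
  proof
    assume "\<Union>H \<subseteq> vec.span {u}"
    then have "vec.dim (\<Union>H) \<le> 1"
      using vec.dim_le_card[of "\<Union>H" "{u}"] by simp
    then show False
      using proj_lines_Union(2)[OF line[OF HA]] by linarith
  qed
  \<comment> \<open>In the basis \<open>u\<close>, \<open>u'\<close>, \<open>e\<close>, the vector
    with coordinates \<alpha>, \<beta>, \<gamma> has x = \<alpha> / \<beta> and y = \<gamma> /
    \<beta>; \<open>u\<close> is the point of \<open>H\<close> at infinity.\<close>
  then obtain u' where u': "u' \<in> \<Union>H" "u' \<notin> vec.span {u}"
    by blast
  have coords: "\<exists>\<alpha> \<beta>. v = \<alpha> *s u + \<beta> *s u'" if v: "v \<in> \<Union>H" for v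
  proof -
    have "v \<in> vec.span {u', u}"
      using proj_line_span[OF line[OF HA] u'(1) u(2,1) u'(2)] v by blast
    then obtain \<beta> \<alpha> where "v - \<beta> *s u' = \<alpha> *s u"
      by (auto simp: vec.span_insert vec.span_singleton)
    then have "v = \<alpha> *s u + \<beta> *s u'"
      by (simp add: algebra_simps)
    then show ?thesis by blast
  qed
  have through_u: "K = K1" if K: "K \<in> A" "e \<in> \<Union>K" "u \<in> \<Union>K" for K
  proof (rule proj_line_eqI[OF line[OF K(1)] line[OF K1(1)] K(3,2) u(3) K1(2) e(1)])
    show "u \<notin> vec.span {e}"
    proof
      assume "u \<in> vec.span {e}"
      then obtain c where "u = c *s e"
        by (auto simp: vec.span_singleton)
      then show False
        using unscale[OF HA, of c e] u(1,2) eH by (cases "c = 0") auto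
    qed
  qed
  have not_both: "\<not> (u \<in> \<Union>L \<and> u' \<in> \<Union>L)" if "L \<in> A" "L \<noteq> H" for L
    using proj_line_eqI[OF line[OF HA] line[OF that(1)] u'(1) u(2) _ _ u(1) u'(2)] that(2) by blast

  \<comment> \<open>Lines off \<open>p\<close> as graphs over \<open>H\<close>\<close>
  define N where "N = A - lines_through A p"
  have N: "L \<in> A" "e \<notin> \<Union>L" if "L \<in> N" for L
    using that through by (auto simp: N_def)
  have "\<exists>a b. u + a *s e \<in> \<Union>L \<and> u' + b *s e \<in> \<Union>L" if "L \<in> N" for L
    using proj_line_complement[OF line[OF N(1)[OF that]] N(2)[OF that]] by metis
  then obtain a b where ab: "u + a L *s e \<in> \<Union>L" "u' + b L *s e \<in> \<Union>L" if "L \<in> N" for L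
    by metis
  \<comment> \<open>\<open>a L\<close> and \<open>b L\<close> are the heights of \<open>L\<close>
    above \<open>u\<close> and \<open>u'\<close>. A vector of \<open>L\<close> at any other height
    than the linear one would differ from a vector of \<open>L\<close> by a nonzero multiple of
    \<open>e\<close>. Dividing by \<beta> gives y = a x + b, hence \<open>f\<close> below.\<close>
  have height: "\<gamma> = \<alpha> * a L + \<beta> * b L"
    if L: "L \<in> N" and "\<alpha> *s u + \<beta> *s u' + \<gamma> *s e \<in> \<Union>L" for L \<alpha> \<beta> \<gamma>
  proof (rule ccontr)
    assume neq: "\<gamma> \<noteq> \<alpha> * a L + \<beta> * b L"
    have "\<alpha> *s (u + a L *s e) + \<beta> *s (u' + b L *s e) \<in> \<Union>L"
      by (intro add scale ab L N(1))
    then have "(\<alpha> *s u + \<beta> *s u' + \<gamma> *s e) -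
      (\<alpha> *s (u + a L *s e) + \<beta> *s (u' + b L *s e)) \<in> \<Union>L"
      using diff[OF N(1)[OF L] that(2)] by blast
    also have "(\<alpha> *s u + \<beta> *s u' + \<gamma> *s e) - (\<alpha> *s (u + a L *s e) + \<beta> *s (u' + b L *s e))
      = (\<gamma> - (\<alpha> * a L + \<beta> * b L)) *s e"
      by (simp add: vec_eq_iff algebra_simps)
    finally show False
      using unscale[OF N(1)[OF L]] N(2)[OF L] neq by (metis right_minus_eq)
  qed
  define f where "f L = [:b L, a L:]" for L
  define T where "T = {t. \<exists>K\<in>lines_through A p. t *s u + u' \<in> \<Union>K}"

  \<comment> \<open>The hypotheses of the affine statement\<close>
  show False
  proof (rule no_saturated_pencil_sections[of "f ` N" T])
    show "finite (f ` N)"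
      using A by (simp add: N_def)
    show "degree l \<le> 1" if "l \<in> f ` N" for l
      using that by (auto simp: f_def)
    have "H \<in> N" using H by (simp add: N_def)
    moreover have "a H = 0" "b H = 0"
      using height[OF \<open>H \<in> N\<close>, of 1 0 0] height[OF \<open>H \<in> N\<close>, of 0 1 0] u(2) u'(1) by auto
    ultimately show "0 \<in> f ` N"
      by (auto simp: f_def image_iff intro!: bexI[of _ H])
    have f_nonzero: "f L \<noteq> 0" if "L \<in> N" "L \<noteq> H" for L
      using ab[OF that(1)] not_both[OF N(1) that(2)] that(1) by (auto simp: f_def)
    show "finite T"
    proof -
      have "\<forall>t\<in>T. \<exists>K. K \<in> lines_through A p \<and> t *s u + u' \<in> \<Union>K"
        unfolding T_def by blast
      then obtain g where g: "g t \<in> lines_through A p" "t *s u + u' \<in> \<Union>(g t)" if "t \<in> T" for t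
        by metis
      \<comment> \<open>Two values of \<open>t\<close> on one line would put \<open>u\<close> and
        \<open>u'\<close> into it, so it would be \<open>H\<close>, which misses
        \<open>e\<close>.\<close>
      have "inj_on g T"
      proof (rule inj_onI, rule ccontr)
        fix s t assume st: "s \<in> T" "t \<in> T" "g s = g t" "s \<noteq> t"
        have gA: "g s \<in> A" "e \<in> \<Union>(g s)"
          using g(1)[OF st(1)] through by auto
        have "(s *s u + u') - (t *s u + u') \<in> \<Union>(g s)"
          by (rule diff[OF gA(1) g(2)[OF st(1)] g(2)[OF st(2), folded st(3)]])
        also have "(s *s u + u') - (t *s u + u') = (s - t) *s u"
          by (simp add: vec_eq_iff algebra_simps)
        finally have ug: "u \<in> \<Union>(g s)"
          using unscale[OF gA(1)] st(4) by (metis right_minus_eq)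
        then have "(s *s u + u') - s *s u \<in> \<Union>(g s)"
          by (intro diff scale gA g(2)[OF st(1)])
        then have "u' \<in> \<Union>(g s)" by simp
        then show False
          using not_both[OF gA(1)] ug gA(2) eH by auto
      qed
      moreover have "g ` T \<subseteq> A"
        using g(1) through by auto
      ultimately show ?thesis
        using A(1) by (metis finite_imageD finite_subset)
    qed
    show "T \<noteq> {}"
    proof -
      have K2: "K2 \<in> A" "e \<in> \<Union>K2"
        using K12 through by auto
      obtain d where d: "d \<noteq> 0" "d \<in> \<Union>H" "d \<in> \<Union>K2"
        using proj_lines_meet[OF line[OF HA] line[OF K2(1)]] .
      obtain \<alpha> \<beta> where \<alpha>\<beta>: "d = \<alpha> *s u + \<beta> *s u'"
        using coords[OF d(2)] by blast
      have "\<beta> \<noteq> 0"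
      proof
        assume "\<beta> = 0"
        then have "u \<in> \<Union>K2"
          using \<alpha>\<beta> d(1,3) unscale[OF K2(1), of \<alpha> u] by auto
        then show False
          using through_u[OF K2] K12(3) by simp
      qed
      then have "d = \<beta> *s ((\<alpha> / \<beta>) *s u + u')"
        by (simp add: \<alpha>\<beta> vec_eq_iff algebra_simps)
      then have "(\<alpha> / \<beta>) *s u + u' \<in> \<Union>K2"
        using d(3) \<open>\<beta> \<noteq> 0\<close> unscale[OF K2(1)] by metis
      then show ?thesis
        using K12(2) unfolding T_def by blast
    qed
    show "\<exists>t\<in>T. poly k t = poly l t"
      if kl: "k \<in> f ` N" "l \<in> f ` N" "coeff k 1 \<noteq> coeff l 1" for k l
    proof -
      obtain L M where L: "L \<in> N" "k = f L" and M: "M \<in> N" "l = f M"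
        using kl by blast
      have slopes: "a L \<noteq> a M"
        using kl(3) by (auto simp: L M f_def)
      then have "L \<noteq> M" by blast
      then obtain K where K: "K \<in> lines_through A p" "L \<inter> M \<subseteq> K"
        using ss L(1) M(1) unfolding supersolvable_with_modular_point_def N_def by metis
      then have KA: "K \<in> A" "e \<in> \<Union>K"
        using through by auto
      obtain z where z: "z \<noteq> 0" "z \<in> \<Union>L" "z \<in> \<Union>M"
        using proj_lines_meet[OF line[OF N(1)[OF L(1)]] line[OF N(1)[OF M(1)]]] .
      then have "vec.span {z} \<in> L \<inter> M"
        using span_in_proj_line_iff[OF line[OF N(1)[OF L(1)]] z(1)]
          span_in_proj_line_iff[OF line[OF N(1)[OF M(1)]] z(1)] by simp
      then have zK: "z \<in> \<Union>K"
        using span_in_proj_line_iff[OF line[OF KA(1)] z(1)] K(2) by (simp add: subset_iff)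
      \<comment> \<open>Project the meeting point \<open>z\<close> from \<open>p\<close> onto
        \<open>H\<close>; the image stays on \<open>K\<close> because \<open>K\<close> contains
        \<open>e\<close>.\<close>
      obtain c where "z + c *s e \<in> \<Union>H"
        using proj_line_complement[OF line[OF HA] eH] .
      then obtain \<alpha> \<beta> where "z + c *s e = \<alpha> *s u + \<beta> *s u'"
        using coords by blast
      then have z': "z = \<alpha> *s u + \<beta> *s u' + (- c) *s e"
        by (simp add: algebra_simps vec_eq_iff)
      have c: "- c = \<alpha> * a L + \<beta> * b L" "- c = \<alpha> * a M + \<beta> * b M"
        using height[OF L(1)] height[OF M(1)] z(2,3) z' by blast+
      \<comment> \<open>With \<beta> = 0 the lines would meet at infinity, and different slopes
        would force \<open>z = 0\<close>.\<close>
      have "\<beta> \<noteq> 0"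
      proof
        assume "\<beta> = 0"
        then have "\<alpha> = 0" using c slopes by auto
        then show False using \<open>\<beta> = 0\<close> c z' z(1) by simp
      qed
      have "z + c *s e \<in> \<Union>K"
        by (intro add scale zK KA)
      also have "z + c *s e = \<beta> *s ((\<alpha> / \<beta>) *s u + u')"
        using \<open>\<beta> \<noteq> 0\<close> by (simp add: z' vec_eq_iff algebra_simps)
      finally have "\<alpha> / \<beta> \<in> T"
        using K(1) unscale[OF KA(1) _ \<open>\<beta> \<noteq> 0\<close>] unfolding T_def by blast
      moreover have "poly k (\<alpha> / \<beta>) = poly l (\<alpha> / \<beta>)"
        using c \<open>\<beta> \<noteq> 0\<close> by (simp add: L M f_def field_simps)
      ultimately show ?thesis by blast
    qed
    \<comment> \<open>The third line \<open>L\<close> at a point of \<open>H\<close> on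
      \<open>K\<close> cannot pass through \<open>p\<close>, since it would then share two points
      with \<open>K\<close>.\<close>
    have other_line: "\<exists>L\<in>N. L \<noteq> H \<and> \<alpha> *s u + \<beta> *s u' \<in> \<Union>L"
      if K: "K \<in> A" "e \<in> \<Union>K" "\<alpha> *s u + \<beta> *s u' \<in> \<Union>K" "\<alpha> *s u + \<beta> *s u' \<noteq> 0" for K \<alpha> \<beta>
    proof -
      let ?d = "\<alpha> *s u + \<beta> *s u'"
      have dH: "?d \<in> \<Union>H"
        by (intro add scale HA u(2) u'(1))
      have "K \<noteq> H" using K(2) eH by blast
      then obtain L where L: "L \<in> A" "L \<noteq> H" "L \<noteq> K" "?d \<in> \<Union>L"
        using no_double_points_third_line[OF A HA n2 K(1) _ K(4) dH K(3)] by blast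
      have "e \<notin> vec.span {?d}"
      proof
        assume "e \<in> vec.span {?d}"
        then have "e \<in> \<Union>H"
          using dH scale[OF HA] by (auto simp only: vec.span_singleton)
        then show False using eH by blast
      qed
      then have "e \<notin> \<Union>L"
        using proj_line_eqI[OF line[OF L(1)] line[OF K(1)] _ L(4) K(2,3,4)] L(3) by blast
      then show ?thesis
        using L through by (auto simp: N_def)
    qed
    show "\<exists>l\<in>f ` N. l \<noteq> 0 \<and> poly l t = 0" if t: "t \<in> T" for t
    proof -
      obtain K where K: "K \<in> A" "e \<in> \<Union>K" "t *s u + u' \<in> \<Union>K"
        using t through unfolding T_def by blast
      have "t *s u + u' \<noteq> 0"
      proof
        assume "t *s u + u' = 0"
        then have "u' = (- t) *s u"
          by (simp add: vec_eq_iff add_eq_0_iff)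
        then show False
          using u'(2) by (metis vec.span_scale vec.span_base singletonI)
      qed
      then obtain L where L: "L \<in> N" "L \<noteq> H" "t *s u + u' \<in> \<Union>L"
        using other_line[OF K(1,2), of t 1] K(3) by auto
      then have "poly (f L) t = 0"
        using height[OF L(1), of t 1 0] by (simp add: f_def algebra_simps)
      then show ?thesis
        using L f_nonzero by blast
    qed
    show "\<exists>l\<in>f ` N. l \<noteq> 0 \<and> coeff l 1 = 0"
    proof -
      \<comment> \<open>The point at infinity of \<open>H\<close> is its crossing with
        \<open>K1\<close>; another line there has slope 0.\<close>
      obtain L where L: "L \<in> N" "L \<noteq> H" "u \<in> \<Union>L"
        using other_line[OF K1, of 1 0] u by auto
      then have "coeff (f L) 1 = 0"
        using height[OF L(1), of 1 0 0] by (simp add: f_def)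
      then show ?thesis
        using L f_nonzero by blast
    qed
  qed
qed

end
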